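(* Let $G$ be a weighted, marked graph. Let $G'$ be the graph obtained by removing every loop from $G$, and interchanging the weights $\alpha(v)$ and $\beta(v)$ of every looped vertex $v$ of $G$. Then $[G]=[G']$.
   Context: A graph $G=(V(G),E(G))$ is finite and may have loops, multiple edges, and free loops (connected components that contain neither vertices nor edges). A marked graph is a graph each of whose vertices is designated either marked or unmarked. A weighted, marked graph is a marked graph given with functions $\alpha,\beta:V(G)\to R$, where $R$ is a commutative ring containing the element $d$. If $V(G)=\{v_1,\dots,v_n\}$, the Boolean adjacency matrix $\mathcal{A}(G)$ is the $n\times n$ matrix over $GF(2)$ with $\mathcal{A}(G)_{ii}=1$ iff $v_i$ is looped and, for $i\neq j$, $\mathcal{A}(G)_{ij}=1$ iff $v_i$ and $v_j$ are adjacent. For $T\subseteq V(G)$, $\mathcal{A}(G)_T$ is obtained from $\mathcal{A}(G)$ by first changing the $i$th diagonal entry whenever $v_i\in T$, and then removing the $i$th row and column whenever $v_i$ is marked and the (new) $i$th diagonal entry is $0$. The weighted marked-graph bracket polynomial is $$[G]=d^{\phi}\sum_{T\subseteq V(G)}\Big(\prod_{v\notin T}\alpha(v)\Big)\Big(\prod_{t\in T}\beta(t)\Big)d^{\nu(\mathcal{A}(G)_T)},$$ where $\phi$ is the number of free loops of $G$ and $\nu$ is the $GF(2)$-nullity (the empty matrix has nullity $0$). Free loops are not affected when loops (edges) at vertices are removed. *)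

theory Defs
  imports
    "HOL-Library.Uprod"
    "HOL-Library.Z2"
    "Jordan_Normal_Form.Matrix_Kernel"
    "Jordan_Normal_Form.DL_Submatrix"
begin

text \<open>
  Edges are named, so parallel edges and several loops at one vertex are possible;
  the ends of an edge form an unordered pair, and \<open>Upair v v\<close> makes it a loop at \<open>v\<close>.
  Free loops are connected components without vertices and edges; only their number matters.
\<close>

record ('v, 'e) graph =
  verts :: "'v set"
  edges :: "'e set"
  ends :: "'e \<Rightarrow> 'v uprod"
  free_loops :: nat

record ('v, 'e) marked_graph = "('v, 'e) graph" +
  marked :: "'v \<Rightarrow> bool"

text \<open>The values of \<open>marked\<close>, \<open>\<alpha>\<close> and \<open>\<beta>\<close> outside \<open>verts\<close> are irrelevant.\<close>

record ('v, 'e, 'r) weighted_marked_graph = "('v, 'e) marked_graph" +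
  \<alpha> :: "'v \<Rightarrow> 'r"
  \<beta> :: "'v \<Rightarrow> 'r"

definition finite_graph :: "('v, 'e, 'z) graph_scheme \<Rightarrow> bool" where
  "finite_graph G \<longleftrightarrow>
     finite (verts G) \<and> finite (edges G) \<and> (\<forall>e\<in>edges G. set_uprod (ends G e) \<subseteq> verts G)"

definition adjacent :: "('v, 'e, 'z) graph_scheme \<Rightarrow> 'v \<Rightarrow> 'v \<Rightarrow> bool" where
  "adjacent G v w \<longleftrightarrow> (\<exists>e\<in>edges G. ends G e = Upair v w)"

definition looped :: "('v, 'e, 'z) graph_scheme \<Rightarrow> 'v \<Rightarrow> bool" where
  "looped G v \<longleftrightarrow> (\<exists>e\<in>edges G. ends G e = Upair v v)"

text \<open>
  Matrices have indices \<open>0, \<dots>, n - 1\<close>, so they are formed with respect to an enumeration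
  \<open>vs = [v\<^sub>1, \<dots>, v\<^sub>n]\<close> of the vertices.
\<close>

definition adj_mat :: "('v, 'e, 'z) graph_scheme \<Rightarrow> 'v list \<Rightarrow> bit mat" where
  "adj_mat G vs = mat (length vs) (length vs) (\<lambda>(i, j).
     of_bool (if i = j then looped G (vs ! i) else adjacent G (vs ! i) (vs ! j)))"

definition toggle_diag :: "'v list \<Rightarrow> 'v set \<Rightarrow> bit mat \<Rightarrow> bit mat" where
  "toggle_diag vs T A = mat (length vs) (length vs) (\<lambda>(i, j).
     if i = j \<and> vs ! i \<in> T then A $$ (i, j) + 1 else A $$ (i, j))"

definition adj_mat_at :: "('v, 'e, 'z) marked_graph_scheme \<Rightarrow> 'v list \<Rightarrow> 'v set \<Rightarrow> bit mat" where
  "adj_mat_at G vs T =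
     (let A = toggle_diag vs T (adj_mat G vs);
          I = {i. i < length vs \<and> \<not> (marked G (vs ! i) \<and> A $$ (i, i) = 0)}
      in submatrix A I I)"

text \<open>
  The sort of the coefficients is that of a commutative ring with unit; unlike
  \<^class>\<open>comm_ring_1\<close> it does not exclude the zero ring.
\<close>

definition bracket_wrt ::
  "'r \<Rightarrow> 'v list \<Rightarrow> ('v, 'e, 'r::{comm_ring, comm_monoid_mult}) weighted_marked_graph \<Rightarrow> 'r" where
  "bracket_wrt d vs G = d ^ free_loops G *
     (\<Sum>T\<in>Pow (verts G).
        (\<Prod>v\<in>verts G - T. \<alpha> G v) * (\<Prod>t\<in>T. \<beta> G t) * d ^ kernel_dim (adj_mat_at G vs T))"

text \<open>The choice of the enumeration does not matter, see \<open>bracket_eq_bracket_wrt\<close> below.\<close>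

definition bracket ::
  "'r \<Rightarrow> ('v, 'e, 'r::{comm_ring, comm_monoid_mult}) weighted_marked_graph \<Rightarrow> 'r" where
  "bracket d G = bracket_wrt d (SOME vs. distinct vs \<and> set vs = verts G) G"

definition remove_loops ::
  "('v, 'e, 'r) weighted_marked_graph \<Rightarrow> ('v, 'e, 'r) weighted_marked_graph" where
  "remove_loops G = G\<lparr>
     edges := {e \<in> edges G. \<not> (\<exists>v. ends G e = Upair v v)},
     \<alpha> := (\<lambda>v. if looped G v then \<beta> G v else \<alpha> G v),
     \<beta> := (\<lambda>v. if looped G v then \<alpha> G v else \<beta> G v)\<rparr>"

lemma finite_graph_remove_loops: "finite_graph G \<Longrightarrow> finite_graph (remove_loops G)"
  by (auto simp: finite_graph_def remove_loops_def)

lemma kernel_dim_empty: "kernel_dim (0\<^sub>m 0 0 :: bit mat) = 0"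
proof -
  have "(0\<^sub>m 0 0 :: bit mat) = 1\<^sub>m 0"
    by (rule eq_matI) auto
  then show ?thesis
    using kernel_one_mat(1)[where 'a = bit and n = 0] by (simp add: kernel_dim_def)
qed

lemma kernel_dim_permute:
  fixes A B :: "'a::field mat"
  assumes A: "A \<in> carrier_mat k k" and B: "B \<in> carrier_mat k k"
    and p: "bij_betw p {..<k} {..<k}"
    and AB: "\<And>i j. i < k \<Longrightarrow> j < k \<Longrightarrow> A $$ (i, j) = B $$ (p i, p j)"
  shows "kernel_dim A = kernel_dim B"
proof -
  define P :: "'a mat" where "P = mat k k (\<lambda>(i, j). of_bool (j = p i))"
  define Q :: "'a mat" where "Q = mat k k (\<lambda>(i, j). of_bool (i = p j))"
  have PC: "P \<in> carrier_mat k k" and QC: "Q \<in> carrier_mat k k"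
    by (auto simp: P_def Q_def)
  have plt: "p i < k" if "i < k" for i
    using p that by (auto simp: bij_betw_def)
  have pinj: "p i = p j \<longleftrightarrow> i = j" if "i < k" "j < k" for i j
    using p that by (auto simp: bij_betw_def inj_on_def)
  have sum1: "(\<Sum>l\<in>{0..<k}. of_bool (l = m) * f l) = f m" if "m < k" for m and f :: "nat \<Rightarrow> 'a"
  proof -
    have "(\<Sum>l\<in>{0..<k}. of_bool (l = m) * f l) = (\<Sum>l\<in>{0..<k}. if l = m then f l else 0)"
      by (rule sum.cong) auto
    then show ?thesis using that by simp
  qed
  have sum2: "(\<Sum>l\<in>{0..<k}. f l * of_bool (l = m)) = f m" if "m < k" for m and f :: "nat \<Rightarrow> 'a"
    using sum1[OF that, of f] by (simp add: mult.commute)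
  have PQ: "P * Q = 1\<^sub>m k"
  proof (rule eq_matI)
    fix i j assume "i < dim_row (1\<^sub>m k :: 'a mat)" "j < dim_col (1\<^sub>m k :: 'a mat)"
    then have ij: "i < k" "j < k" by auto
    have "(P * Q) $$ (i, j) = (\<Sum>l\<in>{0..<k}. of_bool (l = p i) * of_bool (l = p j))"
      using ij by (simp add: P_def Q_def scalar_prod_def)
    also have "\<dots> = of_bool (p i = p j)"
      by (rule sum1[OF plt[OF ij(1)]])
    finally show "(P * Q) $$ (i, j) = 1\<^sub>m k $$ (i, j)"
      using ij pinj[OF ij] by simp
  qed (auto simp: P_def Q_def)
  have QP: "Q * P = 1\<^sub>m k"
    using mat_mult_left_right_inverse[OF PC QC PQ] .
  have PBQ: "A = P * B * Q"
  proof (rule eq_matI)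
    fix i j assume "i < dim_row (P * B * Q)" "j < dim_col (P * B * Q)"
    then have ij: "i < k" "j < k" by (auto simp: P_def Q_def)
    have PB: "(P * B) $$ (i, l) = B $$ (p i, l)" if l: "l < k" for l
    proof -
      have "(P * B) $$ (i, l) = (\<Sum>m\<in>{0..<k}. of_bool (m = p i) * B $$ (m, l))"
        using ij l B by (simp add: P_def scalar_prod_def)
      then show ?thesis using sum1[OF plt[OF ij(1)], of "\<lambda>m. B $$ (m, l)"] by simp
    qed
    have "(P * B * Q) $$ (i, j) = (\<Sum>l\<in>{0..<k}. (P * B) $$ (i, l) * of_bool (l = p j))"
      using ij PC B QC by (subst index_mult_mat) (auto simp: Q_def scalar_prod_def)
    also have "\<dots> = (\<Sum>l\<in>{0..<k}. B $$ (p i, l) * of_bool (l = p j))"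
      by (rule sum.cong) (auto simp: PB)
    also have "\<dots> = B $$ (p i, p j)"
      by (rule sum2[OF plt[OF ij(2)]])
    finally show "A $$ (i, j) = (P * B * Q) $$ (i, j)"
      using AB[OF ij] by simp
  qed (use A in \<open>auto simp: P_def Q_def\<close>)
  have "similar_mat_wit A B P Q"
    unfolding similar_mat_wit_def Let_def using A B PC QC PQ QP PBQ by auto
  from similar_mat_wit_kernel_dim[OF A this] show ?thesis
    using A B by (simp add: kernel_dim_def)
qed

lemma adj_mat_at_entries:
  fixes G :: "('v, 'e, 'z) marked_graph_scheme"
  defines "a \<equiv> \<lambda>T v w. (if v = w \<and> v \<in> T
                   then of_bool (if v = w then looped G v else adjacent G v w) + 1
                   else of_bool (if v = w then looped G v else adjacent G v w)) :: bit"
  defines "W \<equiv> \<lambda>T. {v \<in> verts G. \<not> (marked G v \<and> a T v v = 0)}"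
  assumes vs: "distinct vs" "set vs = verts G"
  obtains f where "bij_betw f {..<card (W T)} (W T)"
    and "adj_mat_at G vs T = mat (card (W T)) (card (W T)) (\<lambda>(i, j). a T (f i) (f j))"
proof -
  define A where "A = toggle_diag vs T (adj_mat G vs)"
  have A_idx: "A $$ (i, j) = a T (vs ! i) (vs ! j)" if "i < length vs" "j < length vs" for i j
    using that nth_eq_iff_index_eq[OF vs(1) that]
    by (simp only: A_def toggle_diag_def adj_mat_def a_def index_mat split)
  define I where "I = {i. i < length vs \<and> \<not> (marked G (vs ! i) \<and> A $$ (i, i) = 0)}"
  have I_eq: "I = {i. i < length vs \<and> vs ! i \<in> W T}"
  proof -
    have "i \<in> I \<longleftrightarrow> i < length vs \<and> vs ! i \<in> W T" for i
    proof (cases "i < length vs")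
      case True
      then have "vs ! i \<in> verts G" using vs(2) nth_mem by metis
      with True show ?thesis
        by (simp only: I_def W_def mem_Collect_eq A_idx[OF True True] simp_thms)
    qed (simp add: I_def)
    then show ?thesis by (simp only: set_eq_iff mem_Collect_eq simp_thms)
  qed
  have finI: "finite I" by (simp add: I_def)
  have vsI: "bij_betw ((!) vs) I (W T)"
    unfolding bij_betw_def
  proof
    show "inj_on ((!) vs) I"
      using vs(1) by (auto simp: I_def inj_on_def nth_eq_iff_index_eq)
    show "(!) vs ` I = W T"
    proof (intro equalityI subsetI)
      fix v assume v: "v \<in> W T"
      then have "v \<in> set vs" using vs(2) by (simp add: W_def)
      then obtain i where "i < length vs" "vs ! i = v" by (auto simp: in_set_conv_nth)
      with v show "v \<in> (!) vs ` I" by (auto simp: I_eq)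
    qed (auto simp: I_eq)
  qed
  then have cardI: "card I = card (W T)" by (rule bij_betw_same_card)
  have pickI: "bij_betw (pick I) {..<card I} I"
    unfolding bij_betw_def
  proof
    show inj: "inj_on (pick I) {..<card I}"
    proof (rule linorder_inj_onI)
      fix x y assume "x < y" "y \<in> {..<card I}"
      then have "pick I x < pick I y" by (intro pick_mono_le) auto
      then show "pick I x \<noteq> pick I y" by simp
    qed auto
    have "pick I ` {..<card I} \<subseteq> I" by (auto intro: pick_in_set_le)
    then show "pick I ` {..<card I} = I"
      using finI inj by (intro card_subset_eq) (auto simp: card_image)
  qed
  have bij: "bij_betw ((!) vs \<circ> pick I) {..<card (W T)} (W T)"
    using bij_betw_trans[OF pickI vsI] cardI by simp
  have dim: "dim_row A = length vs" "dim_col A = length vs"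
    by (auto simp: A_def toggle_diag_def)
  have "{i. i < length vs \<and> i \<in> I} = I" by (auto simp: I_def)
  then have "submatrix A I I = mat (card I) (card I) (\<lambda>(i, j). A $$ (pick I i, pick I j))"
    by (simp add: submatrix_def dim)
  also have "\<dots> = mat (card I) (card I) (\<lambda>(i, j). a T (vs ! pick I i) (vs ! pick I j))"
  proof (rule eq_matI; simp)
    fix i j assume "i < card I" "j < card I"
    then have "pick I i \<in> I" "pick I j \<in> I" by (auto intro: pick_in_set_le)
    then show "A $$ (pick I i, pick I j) = a T (vs ! pick I i) (vs ! pick I j)"
      by (intro A_idx) (auto simp: I_def)
  qed
  finally have "adj_mat_at G vs T =
      mat (card (W T)) (card (W T)) (\<lambda>(i, j). a T (((!) vs \<circ> pick I) i) (((!) vs \<circ> pick I) j))"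
    by (simp only: adj_mat_at_def Let_def cardI o_apply A_def[symmetric] I_def[symmetric])
  with bij show thesis by (rule that)
qed

lemma kernel_dim_adj_mat_at_cong:
  assumes "distinct vs" "set vs = verts G" "distinct ws" "set ws = verts G"
  shows "kernel_dim (adj_mat_at G vs T) = kernel_dim (adj_mat_at G ws T)"
proof -
  define a :: "'a \<Rightarrow> 'a \<Rightarrow> bit" where "a = (\<lambda>v w.
    if v = w \<and> v \<in> T then of_bool (if v = w then looped G v else adjacent G v w) + 1
    else of_bool (if v = w then looped G v else adjacent G v w))"
  define W where "W = {v \<in> verts G. \<not> (marked G v \<and> a v v = 0)}"
  obtain f where f: "bij_betw f {..<card W} W"
    and F: "adj_mat_at G vs T = mat (card W) (card W) (\<lambda>(i, j). a (f i) (f j))"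
    using adj_mat_at_entries[OF assms(1,2), of T] unfolding a_def W_def by blast
  obtain g where g: "bij_betw g {..<card W} W"
    and H: "adj_mat_at G ws T = mat (card W) (card W) (\<lambda>(i, j). a (g i) (g j))"
    using adj_mat_at_entries[OF assms(3,4), of T] unfolding a_def W_def by blast
  define p where "p = inv_into {..<card W} g \<circ> f"
  have p: "bij_betw p {..<card W} {..<card W}"
    unfolding p_def using f bij_betw_inv_into[OF g] by (rule bij_betw_trans)
  have gp: "g (p i) = f i" if "i < card W" for i
    unfolding p_def using f g that
    by (auto simp: bij_betw_def intro!: f_inv_into_f)
  have plt: "p i < card W" if "i < card W" for i
    using p that by (auto simp: bij_betw_def)
  show ?thesis
    by (rule kernel_dim_permute[OF _ _ p]) (auto simp: F H gp plt)
qed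

lemma bracket_eq_bracket_wrt:
  assumes "distinct vs" "set vs = verts G"
  shows "bracket d G = bracket_wrt d vs G"
proof -
  define ws where "ws = (SOME vs. distinct vs \<and> set vs = verts G)"
  have "distinct ws \<and> set ws = verts G"
    unfolding ws_def by (rule someI[of _ vs]) (use assms in simp)
  then show ?thesis
    using kernel_dim_adj_mat_at_cong[of ws G vs] assms
    by (simp add: bracket_def bracket_wrt_def flip: ws_def)
qed

end

theory Submission
  imports Defs
begin

text \<open>
  Let \<open>L\<close> be the set of looped vertices. Toggling the diagonal of \<open>\<A>(G)\<close> at \<open>T\<close> gives the same
  matrix as toggling the diagonal of \<open>\<A>(G')\<close> at the symmetric difference of \<open>T\<close> and \<open>L\<close>, and the
  exchange of weights at \<open>L\<close> makes the corresponding products of weights agree. So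
  \<open>T \<mapsto> T \<triangle> L\<close> matches the terms of \<open>[G]\<close> with those of \<open>[G']\<close>.
\<close>

lemma remove_loops_simps [simp]:
  "verts (remove_loops G) = verts G"
  "free_loops (remove_loops G) = free_loops G"
  "marked (remove_loops G) = marked G"
  "\<alpha> (remove_loops G) v = (if looped G v then \<beta> G v else \<alpha> G v)"
  "\<beta> (remove_loops G) v = (if looped G v then \<alpha> G v else \<beta> G v)"
  by (simp_all add: remove_loops_def)

lemma not_looped_remove_loops [simp]: "\<not> looped (remove_loops G) v"
  by (auto simp: looped_def remove_loops_def)

lemma adjacent_remove_loops [simp]:
  "v \<noteq> w \<Longrightarrow> adjacent (remove_loops G) v w \<longleftrightarrow> adjacent G v w"
  by (auto simp: adjacent_def remove_loops_def)

text \<open>A looped vertex has diagonal entry 1 in \<open>G\<close> and 0 in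
  \<open>remove_loops G\<close>; over GF(2), flipping its membership in \<open>T\<close> makes up
  the difference. Marks agree, so the same rows and columns are deleted.\<close>

lemma adj_mat_at_remove_loops:
  assumes vs: "distinct vs" "set vs = verts G"
  shows "adj_mat_at (remove_loops G) vs (sym_diff T {v \<in> verts G. looped G v}) = adj_mat_at G vs T"
proof -
  have "vs ! i \<in> verts G" if "i < length vs" for i
    using that vs(2) nth_mem by blast
  then have "toggle_diag vs (sym_diff T {v \<in> verts G. looped G v}) (adj_mat (remove_loops G) vs)
      = toggle_diag vs T (adj_mat G vs)"
    by (intro eq_matI) (auto simp: toggle_diag_def adj_mat_def nth_eq_iff_index_eq[OF vs(1)])
  then show ?thesis
    by (simp add: adj_mat_at_def)
qed

text \<open>Merging both products into one over \<open>V\<close> lets weights be compared vertex by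
  vertex.\<close>

lemma weight_prod_conv_if:
  fixes f g :: "'a \<Rightarrow> 'b::comm_monoid_mult"
  assumes "finite V" "T \<subseteq> V"
  shows "(\<Prod>v\<in>V - T. f v) * (\<Prod>v\<in>T. g v) = (\<Prod>v\<in>V. if v \<in> T then g v else f v)"
proof -
  have "(\<Prod>v\<in>V. if v \<in> T then g v else f v)
      = (\<Prod>v\<in>V - T. if v \<in> T then g v else f v) * (\<Prod>v\<in>T. if v \<in> T then g v else f v)"
    using assms by (rule prod.subset_diff[rotated])
  then show ?thesis by simp
qed

theorem theorem2:
  fixes G :: "('v, 'e, 'r::{comm_ring, comm_monoid_mult}) weighted_marked_graph"
    and d :: 'r
  assumes "finite_graph G"
  shows "bracket d G = bracket d (remove_loops G)"
proof -
  have fin: "finite (verts G)"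
    using assms by (simp add: finite_graph_def)
  \<comment> \<open>One enumeration serves both graphs, whose vertices agree.\<close>
  then obtain vs where vs: "distinct vs" "set vs = verts G"
    using finite_distinct_list by blast
  define L where "L = {v \<in> verts G. looped G v}"
  have L: "L \<subseteq> verts G" by (auto simp: L_def)
  have weights: "(\<Prod>v\<in>verts G - T. \<alpha> G v) * (\<Prod>t\<in>T. \<beta> G t)
      = (\<Prod>v\<in>verts G - sym_diff T L. \<alpha> (remove_loops G) v) *
        (\<Prod>t\<in>sym_diff T L. \<beta> (remove_loops G) t)" if T: "T \<subseteq> verts G" for T
  proof -
    have TL: "sym_diff T L \<subseteq> verts G" using T L by blast
    \<comment> \<open>At a vertex of \<open>L\<close> both the membership and the two weights are
      swapped; elsewhere neither is.\<close>
    show ?thesis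
      unfolding weight_prod_conv_if[OF fin T] weight_prod_conv_if[OF fin TL]
      by (rule prod.cong) (auto simp: L_def)
  qed
  have "bracket_wrt d vs G = bracket_wrt d vs (remove_loops G)"
    unfolding bracket_wrt_def remove_loops_simps(1,2)
  \<comment> \<open>The map is its own inverse, and \<open>L \<subseteq> verts G\<close> keeps it
    inside \<open>Pow (verts G)\<close>.\<close>
  proof (rule arg_cong[where f = "(*) _"],
      rule sum.reindex_bij_witness[where i = "\<lambda>T. sym_diff T L" and j = "\<lambda>T. sym_diff T L"])
    fix T assume "T \<in> Pow (verts G)"
    then show "(\<Prod>v\<in>verts G - sym_diff T L. \<alpha> (remove_loops G) v) *
        (\<Prod>t\<in>sym_diff T L. \<beta> (remove_loops G) t) *
        d ^ kernel_dim (adj_mat_at (remove_loops G) vs (sym_diff T L))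
      = (\<Prod>v\<in>verts G - T. \<alpha> G v) * (\<Prod>t\<in>T. \<beta> G t) * d ^ kernel_dim (adj_mat_at G vs T)"
      using weights[of T] adj_mat_at_remove_loops[OF vs, of T] by (simp only: Pow_iff L_def)
  qed (use L in auto)
  then show ?thesis
    using vs by (simp add: bracket_eq_bracket_wrt)
qed

end
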